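(* Let $F\colon\mathbb{N}\to\mathbb{C}$ and let $(f_r)_{r\in\mathbb{N}}$ be the completely even sequence of functions with $f_r(n)=F(\gcd(n,r))$ for $n,r\in\mathbb{N}$. Then the sequence of discrete Fourier transforms $(\widehat{f}_r)_{r\in\mathbb{N}}$ is completely even if and only if $F=c\,\tau$ for some $c\in\mathbb{C}$. In this case $\widehat{f}_r(n)=c\,\sigma(\gcd(n,r))$ for all $n,r\in\mathbb{N}$.
   Context: $\mathbb{N}=\{1,2,\ldots\}$. A sequence $(f_r)_{r\in\mathbb{N}}$ of functions $f_r\colon\mathbb{N}\to\mathbb{C}$ is called completely even if there exists a function $F\colon\mathbb{N}\to\mathbb{C}$ such that $f_r(n)=F(\gcd(n,r))$ for all $n,r\in\mathbb{N}$. For such a sequence each $f_r$ is $r$-periodic and $\widehat{f}_r(n)=\sum_{k=1}^{r}f_r(k)\exp(-2\pi i kn/r)$, $n\in\mathbb{N}$, is its discrete Fourier transform. $\tau(n)$ is the number of positive divisors of $n$ and $\sigma(n)$ is the sum of the positive divisors of $n$. *)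

theory Defs
  imports "HOL-Analysis.Analysis"
begin

text \<open>
  The positive integers are modelled by type \<^typ>\<open>nat\<close> with explicit guards
  \<open>n > 0\<close>; values of arithmetic functions and sequences at \<open>0\<close> are never
  constrained or used.
\<close>

definition completely_even :: "(nat \<Rightarrow> nat \<Rightarrow> complex) \<Rightarrow> bool" where
  "completely_even f \<longleftrightarrow> (\<exists>F :: nat \<Rightarrow> complex. \<forall>r>0. \<forall>n>0. f r n = F (gcd n r))"

definition dft :: "nat \<Rightarrow> (nat \<Rightarrow> complex) \<Rightarrow> nat \<Rightarrow> complex" where
  "dft r g n = (\<Sum>k=1..r. g k * exp (- (2 * of_real pi * \<i> * of_nat k * of_nat n / of_nat r)))"

definition divisor_tau :: "nat \<Rightarrow> nat" where
  "divisor_tau n = card {d. d dvd n}"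

definition divisor_sigma :: "nat \<Rightarrow> nat" where
  "divisor_sigma n = (\<Sum>d | d dvd n. d)"

end

theory Submission
  imports Defs
begin

text \<open>
  Every arithmetic function is a divisor sum, \<open>F n = (\<Sum>d | d dvd n. h d)\<close>, with \<open>h\<close> its
  Moebius inverse. Since \<open>d dvd gcd k r\<close> means that \<open>d\<close> divides \<open>r\<close> and \<open>k\<close> is a multiple of
  \<open>d\<close>, exchanging the two summations in the Fourier transform of \<open>k \<mapsto> F (gcd k r)\<close>
  leaves, for each divisor \<open>d\<close> of \<open>r\<close>, a full sum of \<open>(r div d)\<close>-th roots of unity. That sum is
  \<open>r div d\<close> or \<open>0\<close> according to whether \<open>r div d\<close> divides \<open>n\<close>, so with \<open>e = r div d\<close>
  the transform at \<open>n\<close> is \<open>\<Sum>e | e dvd gcd n r. e * h (r div e)\<close>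
  (lemma \<open>dft_gcd_divisor_sum\<close>).

  Both directions can be read off from this formula. If \<open>F = c \<tau>\<close>, then \<open>h = c\<close> and the sum is
  \<open>c \<sigma>(gcd n r)\<close>. Conversely, at \<open>n = 1\<close> only \<open>e = 1\<close> contributes and the transform equals
  \<open>h r\<close>; complete evenness makes this value depend on \<open>gcd 1 r = 1\<close> only, so \<open>h\<close> is constant
  and \<open>F\<close> is a multiple of \<open>\<tau>\<close>.
\<close>

text \<open>
  The Moebius inverse of \<open>F\<close> is obtained by solving \<open>F n = (\<Sum>d | d dvd n. h d)\<close> for the term
  \<open>d = n\<close>. This recursion determines it without reference to the Moebius function.
\<close>

function moebius_inverse :: "(nat \<Rightarrow> 'a::ab_group_add) \<Rightarrow> nat \<Rightarrow> 'a" where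
  "moebius_inverse F n = F n - (\<Sum>d | d dvd n \<and> d < n. moebius_inverse F d)"
  by auto
termination
  by (relation "Wellfounded.measure snd") auto

declare moebius_inverse.simps [simp del]

lemma sum_divisors_moebius_inverse:
  assumes "n > 0"
  shows "(\<Sum>d | d dvd n. moebius_inverse F d) = F n"
proof -
  have "{d. d dvd n} = insert n {d. d dvd n \<and> d < n}"
    using assms by (auto dest: dvd_imp_le)
  then show ?thesis
    by (simp add: moebius_inverse.simps[of F n])
qed

lemma sum_roots_of_unity:
  fixes m n :: nat
  assumes "m > 0"
  shows "(\<Sum>j=1..m. exp (- (2 * of_real pi * \<i> * of_nat j * of_nat n / of_nat m)))
           = (if m dvd n then of_nat m else (0::complex))"
proof -
  define z where "z = exp (- (2 * of_real pi * \<i> * of_nat n / of_nat m))"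
  have powers: "exp (- (2 * of_real pi * \<i> * of_nat j * of_nat n / of_nat m)) = z ^ j" for j
    unfolding z_def by (simp flip: exp_of_nat_mult add: mult_ac)
  have z_eq_1: "z = 1 \<longleftrightarrow> m dvd n"
    using complex_root_unity_eq_1[of m n] assms by (simp add: z_def exp_minus)
  have z_pow: "z ^ m = 1"
    using complex_root_unity[of m n] assms by (simp add: z_def exp_minus power_inverse)
  have "(\<Sum>j=1..m. z ^ j) = z * (\<Sum>j<m. z ^ j)"
    by (simp add: sum_distrib_left lessThan_atLeast0 atLeastLessThanSuc_atLeastAtMost
             flip: sum.shift_bounds_Suc_ivl power_Suc)
  also have "\<dots> = (if m dvd n then of_nat m else 0)"
  proof (cases "z = 1")
    case True
    then show ?thesis using z_eq_1 by simp
  next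
    case False
    then show ?thesis using z_eq_1 z_pow one_diff_power_eq[of z m] by simp
  qed
  finally show ?thesis by (simp only: powers)
qed

text \<open>
  The multiples \<open>k = d * j\<close> of \<open>d\<close> up to \<open>r\<close> run through all \<open>j \<le> r div d\<close>, and
  the frequency \<open>k / r\<close> reduces to \<open>j / (r div d)\<close>.
\<close>

lemma sum_roots_of_unity_multiples:
  fixes d n r :: nat
  assumes "r > 0" "d dvd r"
  shows "(\<Sum>k | k \<in> {1..r} \<and> d dvd k. exp (- (2 * of_real pi * \<i> * of_nat k * of_nat n / of_nat r)))
           = (if r div d dvd n then of_nat (r div d) else (0::complex))"
proof -
  obtain m where r: "r = d * m" using assms(2) by (elim dvdE)
  then have pos: "d > 0" "m > 0" using assms(1) by auto
  have multiples: "{k. k \<in> {1..r} \<and> d dvd k} = (\<lambda>j. d * j) ` {1..m}"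
    using pos by (auto simp: r elim!: dvdE)
  have "inj_on (\<lambda>j. d * j) {1..m}"
    using pos by (auto intro: inj_onI)
  then have "(\<Sum>k | k \<in> {1..r} \<and> d dvd k. exp (- (2 * of_real pi * \<i> * of_nat k * of_nat n / of_nat r)))
      = (\<Sum>j=1..m. exp (- (2 * of_real pi * \<i> * of_nat (d * j) * of_nat n / of_nat r)))"
    unfolding multiples by (simp add: sum.reindex)
  also have "\<dots> = (\<Sum>j=1..m. exp (- (2 * of_real pi * \<i> * of_nat j * of_nat n / of_nat m)))"
    using pos by (intro sum.cong) (simp_all add: r mult.assoc)
  finally show ?thesis
    using sum_roots_of_unity[OF pos(2)] pos by (simp add: r)
qed

text \<open>
  Only the divisors of \<open>r\<close> contribute to \<open>g\<close>, so \<open>g\<close> is a combination of the indicator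
  functions of the multiples of these \<open>d\<close>, each of which has a transform supported on the
  multiples of \<open>r div d\<close>. With constant \<open>h\<close> the right-hand side is a multiple of \<open>\<sigma>\<close>; at
  \<open>n = 1\<close> it recovers \<open>h r\<close>.
\<close>

lemma dft_gcd_divisor_sum:
  fixes h :: "nat \<Rightarrow> complex"
  assumes "r > 0" "n > 0"
    and g: "\<And>k. k > 0 \<Longrightarrow> g k = (\<Sum>d | d dvd gcd k r. h d)"
  shows "dft r g n = (\<Sum>e | e dvd gcd n r. of_nat e * h (r div e))"
proof -
  let ?E = "\<lambda>k. exp (- (2 * of_real pi * \<i> * of_nat k * of_nat n / of_nat r)) :: complex"
  have fin: "finite {d. d dvd r}"
    using assms(1) by simp
  have "dft r g n = (\<Sum>k=1..r. \<Sum>d | d dvd r \<and> d dvd k. h d * ?E k)"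
    unfolding dft_def by (intro sum.cong) (auto simp: g sum_distrib_right conj_commute)
  also have "\<dots> = (\<Sum>d | d dvd r. \<Sum>k | k \<in> {1..r} \<and> d dvd k. h d * ?E k)"
    using sum.swap_restrict[OF _ fin, of "{1..r}" "\<lambda>k d. h d * ?E k" "\<lambda>k d. d dvd k"] by simp
  also have "\<dots> = (\<Sum>d | d dvd r. h d * (if r div d dvd n then of_nat (r div d) else 0))"
    using sum_roots_of_unity_multiples[OF assms(1), of _ n]
    by (intro sum.cong) (simp_all only: mem_Collect_eq flip: sum_distrib_left)
  also have "\<dots> = (\<Sum>e | e dvd r. h (r div e) * (if e dvd n then of_nat e else 0))"
    \<comment> \<open>substitute the complementary divisor\<close>
    using assms(1)
    by (intro sum.reindex_bij_witness[where i = "\<lambda>e. r div e" and j = "\<lambda>d. r div d"])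
       (auto elim!: dvdE)
  also have "\<dots> = (\<Sum>e | e dvd gcd n r. of_nat e * h (r div e))"
    using fin by (intro sum.mono_neutral_cong_right) auto
  finally show ?thesis .
qed

theorem proposition7:
  fixes F :: "nat \<Rightarrow> complex" and f :: "nat \<Rightarrow> nat \<Rightarrow> complex"
  assumes "\<forall>r>0. \<forall>n>0. f r n = F (gcd n r)"
  shows "(completely_even (\<lambda>r. dft r (f r))
            \<longleftrightarrow> (\<exists>c. \<forall>n>0. F n = c * of_nat (divisor_tau n)))
         \<and> (\<forall>c. (\<forall>n>0. F n = c * of_nat (divisor_tau n)) \<longrightarrow>
               (\<forall>r>0. \<forall>n>0. dft r (f r) n = c * of_nat (divisor_sigma (gcd n r))))"
proof -
  have sigma: "dft r (f r) n = c * of_nat (divisor_sigma (gcd n r))"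
    if tau: "\<forall>n>0. F n = c * of_nat (divisor_tau n)" and pos: "r > 0" "n > 0" for c r n
  proof -
    have "f r k = (\<Sum>d | d dvd gcd k r. c)" if "k > 0" for k
      using assms tau pos that by (simp add: divisor_tau_def mult.commute)
    then have "dft r (f r) n = (\<Sum>e | e dvd gcd n r. of_nat e * c)"
      using pos by (intro dft_gcd_divisor_sum)
    then show ?thesis
      by (simp add: divisor_sigma_def sum_distrib_left mult.commute)
  qed
  have tau: "\<exists>c. \<forall>n>0. F n = c * of_nat (divisor_tau n)"
    if even: "completely_even (\<lambda>r. dft r (f r))"
  proof -
    obtain G where G: "\<And>r n. r > 0 \<Longrightarrow> n > 0 \<Longrightarrow> dft r (f r) n = G (gcd n r)"
      using even unfolding completely_even_def by blast
    have inverse_const: "moebius_inverse F r = G 1" if "r > 0" for r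
    proof -
      have "f r k = (\<Sum>d | d dvd gcd k r. moebius_inverse F d)" if "k > 0" for k
        using assms \<open>r > 0\<close> that sum_divisors_moebius_inverse[of "gcd k r" F] by simp
      then have "dft r (f r) 1 = (\<Sum>e | e dvd gcd 1 r. of_nat e * moebius_inverse F (r div e))"
        using that by (intro dft_gcd_divisor_sum) auto
      then show ?thesis
        using G[of r 1] that by simp
    qed
    have "F n = G 1 * of_nat (divisor_tau n)" if "n > 0" for n
    proof -
      have "F n = (\<Sum>d | d dvd n. moebius_inverse F d)"
        by (rule sum_divisors_moebius_inverse[OF that, symmetric])
      also have "\<dots> = (\<Sum>d | d dvd n. G 1)"
        using that by (intro sum.cong refl inverse_const) (auto intro: dvd_pos_nat)
      finally show ?thesis
        by (simp add: divisor_tau_def mult.commute)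
    qed
    then show ?thesis by blast
  qed
  have "completely_even (\<lambda>r. dft r (f r))"
    if "\<forall>n>0. F n = c * of_nat (divisor_tau n)" for c
    unfolding completely_even_def
    by (rule exI[of _ "\<lambda>m. c * of_nat (divisor_sigma m)"]) (use sigma[OF that] in blast)
  then show ?thesis
    using sigma tau by blast
qed

end
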